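(* Let $d\in\mathbb{N}$. A generator $L:\mathcal{U}_d\to\mathbb{C}$ is Gaussian if and only if it is of the form $$L=\sum_{j,k,l,m=1}^d\sigma_{jk,lm}\,G_{jk,lm}+\sum_{j,k=1}^db_{jk}\,D_{jk}$$ with a hermitian $d\times d$-matrix $(b_{jk})$ and a positive semi-definite $d^2\times d^2$-matrix $(\sigma_{jk,lm})$. It is a drift if and only if $\sigma_{jk,lm}=0$ for $j,k,l,m=1,\ldots,d$.
   Context: $\mathcal{U}_d$ is the complex unital $*$-algebra generated by non-commuting indeterminates $u_{ij},u_{ij}^*$, $i,j=1,\ldots,d$, with relations $\sum_ju_{kj}u_{\ell j}^*=\delta_{k\ell}\mathbf{1}=\sum_ju_{jk}^*u_{j\ell}$; it is a $*$-bialgebra with $\Delta(u_{k\ell})=\sum_ju_{kj}\otimes u_{j\ell}$, $\varepsilon(u_{k\ell})=\delta_{k\ell}$. Put $\hat u_{jk}=u_{jk}-\delta_{jk}\mathbf{1}$, $\mathcal{U}_d^0=K=\ker\varepsilon$, $K^2=\mathrm{span}\{ab:a,b\in K\}$, $K^3=\mathrm{span}\{abc:a,b,c\in K\}$. A generator is a linear functional $L:\mathcal{U}_d\to\mathbb{C}$ with $L(\mathbf{1})=0$, $L(b^* )=\overline{L(b)}$, and $L(b^*b)\ge0$ whenever $\varepsilon(b)=0$. It is called Gaussian if $L|_{K^3}=0$, and a drift if $L|_{K^2}=0$. For $A=(a_{jk})\in\mathcal{M}_d(\mathbb{C})$ let $\eta_A:\mathcal{U}_d\to\mathbb{C}$ be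 the linear functional with $\eta_A(\mathbf{1})=0$, $\eta_A|_{K^2}=0$, $\eta_A(\hat u_{jk})=a_{jk}$, $\eta_A(\hat u_{jk}^* )=-a_{kj}$. Let $E_{jk}$ be the standard matrix units. $D_{jk}:\mathcal{U}_d\to\mathbb{C}$ is the linear functional with $D_{jk}(\mathbf{1})=0$, $D_{jk}|_{K^2}=0$, $D_{jk}(\hat u_{rs})=i\,\delta_{jr}\delta_{ks}$, $D_{jk}(\hat u_{rs}^* )=-i\,\delta_{js}\delta_{kr}$. $G_{jk,lm}:\mathcal{U}_d\to\mathbb{C}$ is the linear functional with $G_{jk,lm}(\mathbf{1})=0$, $G_{jk,lm}(\hat u_{rs})=-\frac12(E_{jk}^*E_{lm})_{rs}=-\frac12\delta_{kr}\delta_{jl}\delta_{ms}$, $G_{jk,lm}(\hat u_{rs}^* )=-\frac12(E_{jk}^*E_{lm})_{sr}=-\frac12\delta_{ks}\delta_{jl}\delta_{mr}$, and $G_{jk,lm}(uv)=\overline{\eta_{E_{jk}}(u^* )}\,\eta_{E_{lm}}(v)$ for $u,v\in\mathcal{U}_d^0$. *)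

theory Defs
  imports "HOL-Analysis.Analysis" "HOL-Library.Poly_Mapping" "HOL-Library.Nonpos_Ints"
begin

section \<open>The free algebra on the indeterminates\<close>

text \<open>
  The index set of size d is a finite type \<open>'n\<close>. \<open>U j k\<close> stands for the indeterminate
  $u_{jk}$ and \<open>Us j k\<close> for $u_{jk}^*$. Words are written as an additive monoid (concatenation
  is addition) because that is the convention of \<^theory>\<open>HOL-Library.Poly_Mapping\<close>, which
  then supplies the monoid algebra, i.e. the algebra of non-commutative polynomials.
\<close>

datatype 'n letter = U 'n 'n | Us 'n 'n

datatype 'n monomial = Mono (letters: "'n letter list")

instantiation monomial :: (type) monoid_add
begin

definition zero_monomial :: "'a monomial"
  where "0 = Mono []"

definition plus_monomial :: "'a monomial \<Rightarrow> 'a monomial \<Rightarrow> 'a monomial"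
  where "v + w = Mono (letters v @ letters w)"

instance
  by standard (simp_all add: zero_monomial_def plus_monomial_def)

end

type_synonym 'n free_alg = "'n monomial \<Rightarrow>\<^sub>0 complex"

abbreviation const :: "complex \<Rightarrow> 'n free_alg"
  where "const c \<equiv> Poly_Mapping.single 0 c"

definition gen :: "'n letter \<Rightarrow> 'n free_alg"
  where "gen a = Poly_Mapping.single (Mono [a]) 1"

lemma free_alg_induct [case_names single add]:
  fixes p :: "'n free_alg"
  assumes s: "\<And>w c. P (Poly_Mapping.single w c)"
    and a: "\<And>p q. P p \<Longrightarrow> P q \<Longrightarrow> P (p + q)"
  shows "P p"
proof (induction p rule: update_induct)
  case const
  show ?case using s[of 0 0] by simp
next
  case (update f w c)
  have "Poly_Mapping.update w c f = f + Poly_Mapping.single w c"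
    by (rule poly_mapping_eqI)
      (use update.hyps in \<open>auto simp: lookup_update lookup_add lookup_single when_def in_keys_iff\<close>)
  then show ?case using a[OF update.IH s] by simp
qed


subsection \<open>Involution\<close>

fun letter_star :: "'n letter \<Rightarrow> 'n letter"
  where
    "letter_star (U j k) = Us j k"
  | "letter_star (Us j k) = U j k"

definition mono_star :: "'n monomial \<Rightarrow> 'n monomial"
  where "mono_star w = Mono (rev (map letter_star (letters w)))"

lemma letter_star_star [simp]: "letter_star (letter_star a) = a"
  by (cases a) auto

lemma mono_star_star [simp]: "mono_star (mono_star w) = w"
  by (cases w) (simp add: mono_star_def rev_map comp_def)

lemma mono_star_add: "mono_star (v + w) = mono_star w + mono_star v"
  by (simp add: mono_star_def plus_monomial_def)

lemma mono_star_zero [simp]: "mono_star 0 = 0"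
  by (simp add: mono_star_def zero_monomial_def)

lift_definition free_star :: "'n free_alg \<Rightarrow> 'n free_alg"
  is "\<lambda>p w. cnj (p (mono_star w))"
proof -
  fix p :: "'n monomial \<Rightarrow> complex"
  assume f: "finite {w. p w \<noteq> 0}"
  have "{w. cnj (p (mono_star w)) \<noteq> 0} \<subseteq> mono_star ` {w. p w \<noteq> 0}"
    by (auto intro!: image_eqI[where x = "mono_star _"])
  with f show "finite {w. cnj (p (mono_star w)) \<noteq> 0}"
    by (rule finite_surj)
qed

lemma free_star_single [simp]:
  "free_star (Poly_Mapping.single w c) = Poly_Mapping.single (mono_star w) (cnj c)"
  by (rule poly_mapping_eqI)
    (auto simp: free_star.rep_eq lookup_single when_def dest: arg_cong[where f = mono_star])

lemma free_star_add: "free_star (p + q) = free_star p + free_star q"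
  by (rule poly_mapping_eqI) (simp add: free_star.rep_eq lookup_add)

lemma free_star_0 [simp]: "free_star 0 = 0"
  by (rule poly_mapping_eqI) (simp add: free_star.rep_eq)

lemma free_star_1 [simp]: "free_star 1 = 1"
  by (metis free_star_single mono_star_zero complex_cnj_one single_one)

lemma free_star_diff: "free_star (p - q) = free_star p - free_star q"
  by (rule poly_mapping_eqI) (simp add: free_star.rep_eq lookup_minus)

lemma free_star_sum: "free_star (sum f A) = (\<Sum>x\<in>A. free_star (f x))"
  by (induction A rule: infinite_finite_induct) (simp_all add: free_star_add)

lemma free_star_mult: "free_star (p * q) = free_star q * free_star p"
proof (induction p rule: free_alg_induct)
  case (single v c)
  show ?case
    by (induction q rule: free_alg_induct)
      (simp_all add: mult_single mono_star_add mult.commute distrib_left distrib_right free_star_add)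
qed (simp add: distrib_left distrib_right free_star_add)

lemma free_star_star [simp]: "free_star (free_star p) = p"
  by (rule poly_mapping_eqI) (simp add: free_star.rep_eq)

lemma free_star_gen [simp]: "free_star (gen a) = gen (letter_star a)"
  by (simp add: gen_def mono_star_def)


subsection \<open>Linear extension and evaluation at scalars\<close>

definition lin_ext :: "('n monomial \<Rightarrow> complex) \<Rightarrow> 'n free_alg \<Rightarrow> complex"
  where "lin_ext f p = (\<Sum>w\<in>Poly_Mapping.keys p. Poly_Mapping.lookup p w * f w)"

lemma lin_ext_single [simp]: "lin_ext f (Poly_Mapping.single w c) = c * f w"
  by (simp add: lin_ext_def)

lemma lin_ext_add: "lin_ext f (p + q) = lin_ext f p + lin_ext f q"
  unfolding lin_ext_def by (rule setsum_keys_plus_distrib) (simp_all add: distrib_right)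

lemma lin_ext_0 [simp]: "lin_ext f 0 = 0"
  by (simp add: lin_ext_def)

lemma lin_ext_1 [simp]: "lin_ext f 1 = f 0"
  by (simp flip: single_one)

lemma lin_ext_gen [simp]: "lin_ext f (gen a) = f (Mono [a])"
  by (simp add: gen_def)

lemma lin_ext_diff: "lin_ext f (p - q) = lin_ext f p - lin_ext f q"
  by (metis add_diff_cancel_right' diff_add_cancel lin_ext_add)

lemma lin_ext_sum: "lin_ext f (sum g A) = (\<Sum>x\<in>A. lin_ext f (g x))"
  by (induction A rule: infinite_finite_induct) (simp_all add: lin_ext_add)

lemma lin_ext_const_mult: "lin_ext f (const c * p) = c * lin_ext f p"
  by (induction p rule: free_alg_induct)
    (simp_all add: mult_single distrib_left lin_ext_add)

definition free_eval :: "('n letter \<Rightarrow> complex) \<Rightarrow> 'n free_alg \<Rightarrow> complex"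
  where "free_eval \<phi> = lin_ext (\<lambda>w. prod_list (map \<phi> (letters w)))"

lemma free_eval_mult: "free_eval \<phi> (p * q) = free_eval \<phi> p * free_eval \<phi> q"
proof (induction p rule: free_alg_induct)
  case (single v c)
  show ?case
    by (induction q rule: free_alg_induct)
      (simp_all add: free_eval_def mult_single plus_monomial_def distrib_left lin_ext_add)
qed (simp add: free_eval_def distrib_right lin_ext_add)

lemma free_eval_gen [simp]: "free_eval \<phi> (gen a) = \<phi> a"
  by (simp add: free_eval_def)

lemma free_eval_1 [simp]: "free_eval \<phi> 1 = 1"
  by (simp add: free_eval_def zero_monomial_def)

lemmas free_eval_linear =
  lin_ext_0 [of "\<lambda>w. prod_list (map \<phi> (letters w))" for \<phi>, folded free_eval_def]
  lin_ext_add [of "\<lambda>w. prod_list (map \<phi> (letters w))" for \<phi>, folded free_eval_def]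
  lin_ext_diff [of "\<lambda>w. prod_list (map \<phi> (letters w))" for \<phi>, folded free_eval_def]
  lin_ext_sum [of "\<lambda>w. prod_list (map \<phi> (letters w))" for \<phi>, folded free_eval_def]
  lin_ext_const_mult [of "\<lambda>w. prod_list (map \<phi> (letters w))" for \<phi>, folded free_eval_def]


section \<open>The algebra with unitary matrix of generators\<close>

text \<open>The ideal generated by the relators is automatically closed under the involution.\<close>

definition relators :: "('n::finite) free_alg set"
  where "relators =
    {(\<Sum>j\<in>UNIV. gen (U k j) * gen (Us l j)) - (if k = l then 1 else 0) | k l. True} \<union>
    {(\<Sum>j\<in>UNIV. gen (Us j k) * gen (U j l)) - (if k = l then 1 else 0) | k l. True}"

inductive_set rel_ideal :: "('n::finite) free_alg set"
  where
    zero: "0 \<in> rel_ideal"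
  | relator: "r \<in> relators \<Longrightarrow> a * r * b \<in> rel_ideal"
  | add: "x \<in> rel_ideal \<Longrightarrow> y \<in> rel_ideal \<Longrightarrow> x + y \<in> rel_ideal"

lemma rel_ideal_left: "x \<in> rel_ideal \<Longrightarrow> a * x \<in> rel_ideal"
proof (induction rule: rel_ideal.induct)
  case (relator r c b)
  then show ?case using rel_ideal.relator[of r "a * c" b] by (simp add: mult.assoc)
qed (auto simp: distrib_left intro: rel_ideal.intros)

lemma rel_ideal_right: "x \<in> rel_ideal \<Longrightarrow> x * a \<in> rel_ideal"
proof (induction rule: rel_ideal.induct)
  case (relator r c b)
  then show ?case using rel_ideal.relator[of r c "b * a"] by (simp add: mult.assoc)
qed (auto simp: distrib_right intro: rel_ideal.intros)

lemma rel_ideal_uminus: "x \<in> rel_ideal \<Longrightarrow> - x \<in> rel_ideal"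
  using rel_ideal_left[of x "- 1"] by simp

lemma rel_ideal_diff: "x \<in> rel_ideal \<Longrightarrow> y \<in> rel_ideal \<Longrightarrow> x - y \<in> rel_ideal"
  using rel_ideal.add[of x "- y"] rel_ideal_uminus[of y] by simp

lemma relatorsE:
  assumes "r \<in> relators"
  obtains k l where "r = (\<Sum>j\<in>UNIV. gen (U k j) * gen (Us l j)) - (if k = l then 1 else 0)"
  | k l where "r = (\<Sum>j\<in>UNIV. gen (Us j k) * gen (U j l)) - (if k = l then 1 else 0)"
  using assms unfolding relators_def by blast

lemma relators_star:
  assumes "r \<in> relators"
  shows "free_star r \<in> relators"
  using assms
proof (cases rule: relatorsE)
  case (1 k l)
  then have "free_star r = (\<Sum>j\<in>UNIV. gen (U l j) * gen (Us k j)) - (if l = k then 1 else 0)"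
    by (auto simp: free_star_diff free_star_sum free_star_mult)
  then show ?thesis unfolding relators_def by blast
next
  case (2 k l)
  then have "free_star r = (\<Sum>j\<in>UNIV. gen (Us j l) * gen (U j k)) - (if l = k then 1 else 0)"
    by (auto simp: free_star_diff free_star_sum free_star_mult)
  then show ?thesis unfolding relators_def by blast
qed

lemma rel_ideal_star: "x \<in> rel_ideal \<Longrightarrow> free_star x \<in> rel_ideal"
proof (induction rule: rel_ideal.induct)
  case (relator r a b)
  then show ?case
    using rel_ideal.relator[OF relators_star, of r "free_star b" "free_star a"]
    by (simp add: free_star_mult mult.assoc)
qed (auto simp: free_star_add intro: rel_ideal.intros)

fun counit_letter :: "'n letter \<Rightarrow> complex"
  where
    "counit_letter (U j k) = (if j = k then 1 else 0)"
  | "counit_letter (Us j k) = (if j = k then 1 else 0)"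

lemma relators_counit:
  assumes "r \<in> relators"
  shows "free_eval counit_letter r = 0"
  using assms
proof (cases rule: relatorsE)
  case (1 k l)
  have "free_eval counit_letter (if k = l then 1 else 0) = (if k = l then 1 else 0)"
    by (simp add: free_eval_linear)
  then show ?thesis
    by (simp add: 1 free_eval_linear free_eval_mult if_distrib[where f = "\<lambda>c. c * _"] cong: if_cong)
next
  case (2 k l)
  have "free_eval counit_letter (if k = l then 1 else 0) = (if k = l then 1 else 0)"
    by (simp add: free_eval_linear)
  then show ?thesis
    by (simp add: 2 free_eval_linear free_eval_mult if_distrib[where f = "\<lambda>c. c * _"] cong: if_cong)
qed

lemma rel_ideal_counit: "x \<in> rel_ideal \<Longrightarrow> free_eval counit_letter x = 0"
  by (induction rule: rel_ideal.induct)
    (simp_all add: free_eval_linear free_eval_mult relators_counit)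

definition rel_cong :: "('n::finite) free_alg \<Rightarrow> 'n free_alg \<Rightarrow> bool"
  where "rel_cong p q \<longleftrightarrow> p - q \<in> rel_ideal"

lemma rel_cong_equivp: "equivp rel_cong"
proof (rule equivpI)
  show "reflp rel_cong"
    by (auto simp: reflp_def rel_cong_def intro: rel_ideal.zero)
  show "symp rel_cong"
    using rel_ideal_uminus by (fastforce simp: symp_def rel_cong_def)
  show "transp rel_cong"
    using rel_ideal.add by (fastforce simp: transp_def rel_cong_def)
qed

quotient_type (overloaded) 'n unitary_alg = "('n::finite) free_alg" / rel_cong
  by (rule rel_cong_equivp)

instantiation unitary_alg :: (finite) ring_1
begin

lift_definition zero_unitary_alg :: "'a unitary_alg" is 0 .

lift_definition one_unitary_alg :: "'a unitary_alg" is 1 .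

lift_definition plus_unitary_alg :: "'a unitary_alg \<Rightarrow> 'a unitary_alg \<Rightarrow> 'a unitary_alg" is "(+)"
  unfolding rel_cong_def by (metis add_diff_add rel_ideal.add)

lift_definition minus_unitary_alg :: "'a unitary_alg \<Rightarrow> 'a unitary_alg \<Rightarrow> 'a unitary_alg" is "(-)"
proof -
  fix p p' q q' :: "'a free_alg"
  assume "rel_cong p p'" "rel_cong q q'"
  then have "(p - p') - (q - q') \<in> rel_ideal"
    unfolding rel_cong_def by (rule rel_ideal_diff)
  then show "rel_cong (p - q) (p' - q')"
    by (simp add: rel_cong_def algebra_simps)
qed

lift_definition uminus_unitary_alg :: "'a unitary_alg \<Rightarrow> 'a unitary_alg" is uminus
  unfolding rel_cong_def by (metis minus_diff_eq minus_diff_minus rel_ideal_uminus)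

lift_definition times_unitary_alg :: "'a unitary_alg \<Rightarrow> 'a unitary_alg \<Rightarrow> 'a unitary_alg" is "(*)"
proof -
  fix p p' q q' :: "'a free_alg"
  assume "rel_cong p p'" "rel_cong q q'"
  then have "(p - p') * q + p' * (q - q') \<in> rel_ideal"
    unfolding rel_cong_def by (intro rel_ideal.add rel_ideal_left rel_ideal_right)
  then show "rel_cong (p * q) (p' * q')"
    by (simp add: rel_cong_def algebra_simps)
qed

instance
proof
  show "(0::'a unitary_alg) \<noteq> 1"
  proof (transfer, rule notI)
    assume "rel_cong (0::'a free_alg) 1"
    then have "free_eval counit_letter (0 - 1 :: 'a free_alg) = 0"
      unfolding rel_cong_def by (rule rel_ideal_counit)
    then show False by (simp add: free_eval_linear del: diff_0)
  qed
qed (transfer; simp add: algebra_simps equivp_reflp[OF rel_cong_equivp])+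

end

lift_definition scaleU :: "complex \<Rightarrow> ('n::finite) unitary_alg \<Rightarrow> 'n unitary_alg"
  is "\<lambda>c p. const c * p"
  unfolding rel_cong_def by (metis right_diff_distrib rel_ideal_left)

lift_definition ugen :: "'n \<Rightarrow> 'n \<Rightarrow> ('n::finite) unitary_alg"
  is "\<lambda>j k. gen (U j k)" .

lift_definition starU :: "('n::finite) unitary_alg \<Rightarrow> 'n unitary_alg"
  is free_star
  unfolding rel_cong_def by (metis free_star_diff rel_ideal_star)

lift_definition counit :: "('n::finite) unitary_alg \<Rightarrow> complex"
  is "free_eval counit_letter"
  unfolding rel_cong_def by (metis free_eval_linear(3) rel_ideal_counit eq_iff_diff_eq_0)

interpretation unitary_alg: vector_space "scaleU :: complex \<Rightarrow> ('n::finite) unitary_alg \<Rightarrow> _"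
proof
  fix a b :: complex and x y :: "'n unitary_alg"
  show "scaleU a (x + y) = scaleU a x + scaleU a y"
    by transfer (simp add: distrib_left equivp_reflp[OF rel_cong_equivp])
  show "scaleU (a + b) x = scaleU a x + scaleU b x"
    by transfer (simp add: distrib_right single_add equivp_reflp[OF rel_cong_equivp])
  show "scaleU a (scaleU b x) = scaleU (a * b) x"
    by transfer (simp add: mult_single flip: mult.assoc, rule equivp_reflp[OF rel_cong_equivp])
  show "scaleU 1 x = x"
    by transfer (simp add: equivp_reflp[OF rel_cong_equivp])
qed

lemma scaleU_mult_left: "scaleU c x * y = scaleU c (x * y)"
  by transfer (simp add: mult.assoc equivp_reflp[OF rel_cong_equivp])

lemma scaleU_mult_right: "x * scaleU c y = scaleU c (x * y)"
proof transfer
  fix p q :: "'a free_alg" and c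
  have "p * const c = const c * p"
    by (induction p rule: free_alg_induct)
      (simp_all add: mult_single mult.commute distrib_left distrib_right)
  then show "rel_cong (p * (const c * q)) (const c * (p * q))"
    by (simp flip: mult.assoc add: equivp_reflp[OF rel_cong_equivp])
qed

lemma starU_add: "starU (x + y) = starU x + starU y"
  by transfer (simp add: free_star_add equivp_reflp[OF rel_cong_equivp])

lemma starU_mult: "starU (x * y) = starU y * starU x"
  by transfer (simp add: free_star_mult equivp_reflp[OF rel_cong_equivp])

lemma starU_scaleU: "starU (scaleU c x) = scaleU (cnj c) (starU x)"
proof transfer
  fix c and p :: "'a free_alg"
  have "free_star p * const (cnj c) = const (cnj c) * free_star p"
    by (induction p rule: free_alg_induct)
      (simp_all add: mult_single mult.commute distrib_left distrib_right free_star_add)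
  then show "rel_cong (free_star (const c * p)) (const (cnj c) * free_star p)"
    by (simp add: free_star_mult equivp_reflp[OF rel_cong_equivp])
qed

lemma starU_starU [simp]: "starU (starU x) = x"
  by transfer (simp add: equivp_reflp[OF rel_cong_equivp])

lemma starU_1 [simp]: "starU 1 = 1"
  by transfer (simp add: equivp_reflp[OF rel_cong_equivp])

lemma starU_diff: "starU (x - y) = starU x - starU y"
  by transfer (simp add: free_star_diff equivp_reflp[OF rel_cong_equivp])

lemma counit_mult: "counit (x * y) = counit x * counit y"
  by transfer (rule free_eval_mult)

lemma counit_add: "counit (x + y) = counit x + counit y"
  by transfer (rule free_eval_linear)

lemma counit_diff: "counit (x - y) = counit x - counit y"
  by transfer (rule free_eval_linear)

lemma counit_1 [simp]: "counit 1 = 1"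
  by transfer simp

lemma counit_scaleU: "counit (scaleU c x) = c * counit x"
  by transfer (rule free_eval_linear)

lemma counit_ugen [simp]:
  "counit (ugen j k) = (if j = k then 1 else 0)"
  "counit (starU (ugen j k)) = (if j = k then 1 else 0)"
  by (transfer; simp)+

lemma abs_sum: "abs_unitary_alg (sum f A) = (\<Sum>x\<in>A. abs_unitary_alg (f x))"
  by (induction A rule: infinite_finite_induct)
    (simp_all add: zero_unitary_alg_def plus_unitary_alg.abs_eq[symmetric])

lemma ugen_relations:
  "(\<Sum>j\<in>UNIV. ugen k j * starU (ugen l j)) = (if k = l then 1 else 0)"
  "(\<Sum>j\<in>UNIV. starU (ugen j k) * ugen j l) = (if k = l then 1 else 0)"
proof -
  have *: "abs_unitary_alg p = (if k = l then 1 else 0)"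
    if "p - (if k = l then 1 else 0) \<in> relators" for p :: "'a free_alg"
    using rel_ideal.relator[OF that, of 1 1]
    by (auto simp: zero_unitary_alg_def one_unitary_alg_def unitary_alg.abs_eq_iff rel_cong_def
        split: if_splits)
  have "abs_unitary_alg (\<Sum>j\<in>UNIV. gen (U k j) * gen (Us l j)) = (if k = l then 1 else 0)"
    by (rule *) (unfold relators_def, blast)
  then show "(\<Sum>j\<in>UNIV. ugen k j * starU (ugen l j)) = (if k = l then 1 else 0)"
    by (simp add: ugen_def starU.abs_eq times_unitary_alg.abs_eq abs_sum)
  have "abs_unitary_alg (\<Sum>j\<in>UNIV. gen (Us j k) * gen (U j l)) = (if k = l then 1 else 0)"
    by (rule *) (unfold relators_def, blast)
  then show "(\<Sum>j\<in>UNIV. starU (ugen j k) * ugen j l) = (if k = l then 1 else 0)"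
    by (simp add: ugen_def starU.abs_eq times_unitary_alg.abs_eq abs_sum)
qed


section \<open>Generators\<close>

definition linear_functional :: "(('n::finite) unitary_alg \<Rightarrow> complex) \<Rightarrow> bool"
  where "linear_functional f \<longleftrightarrow> Vector_Spaces.linear scaleU (*) f"

definition ker_counit :: "('n::finite) unitary_alg set"
  where "ker_counit = {x. counit x = 0}"

definition ker_counit2 :: "('n::finite) unitary_alg set"
  where "ker_counit2 = unitary_alg.span {a * b | a b. a \<in> ker_counit \<and> b \<in> ker_counit}"

definition ker_counit3 :: "('n::finite) unitary_alg set"
  where "ker_counit3 = unitary_alg.span
    {a * b * c | a b c. a \<in> ker_counit \<and> b \<in> ker_counit \<and> c \<in> ker_counit}"

definition generator :: "(('n::finite) unitary_alg \<Rightarrow> complex) \<Rightarrow> bool"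
  where "generator L \<longleftrightarrow> linear_functional L \<and> L 1 = 0 \<and> (\<forall>b. L (starU b) = cnj (L b)) \<and>
    (\<forall>b. counit b = 0 \<longrightarrow> L (starU b * b) \<in> \<real>\<^sub>\<ge>\<^sub>0)"

definition gaussian :: "(('n::finite) unitary_alg \<Rightarrow> complex) \<Rightarrow> bool"
  where "gaussian L \<longleftrightarrow> generator L \<and> (\<forall>x\<in>ker_counit3. L x = 0)"

definition drift :: "(('n::finite) unitary_alg \<Rightarrow> complex) \<Rightarrow> bool"
  where "drift L \<longleftrightarrow> generator L \<and> (\<forall>x\<in>ker_counit2. L x = 0)"


section \<open>The basic functionals\<close>

definition uhat :: "'n \<Rightarrow> 'n \<Rightarrow> ('n::finite) unitary_alg"
  where "uhat j k = ugen j k - (if j = k then 1 else 0)"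

definition cadjoint :: "complex^'n^'m \<Rightarrow> complex^'m^'n"
  where "cadjoint A = (\<chi> i j. cnj (A $ j $ i))"

definition hermitian_matrix :: "complex^'n^'n \<Rightarrow> bool"
  where "hermitian_matrix A \<longleftrightarrow> cadjoint A = A"

text \<open>Over the complex numbers the condition below already forces \<open>A\<close> to be hermitian.\<close>

definition pos_semidef_matrix :: "complex^('n::finite)^'n \<Rightarrow> bool"
  where "pos_semidef_matrix A \<longleftrightarrow>
    (\<forall>v. (\<Sum>i\<in>UNIV. \<Sum>j\<in>UNIV. cnj (v $ i) * A $ i $ j * v $ j) \<in> \<real>\<^sub>\<ge>\<^sub>0)"

definition matrix_unit :: "'n \<Rightarrow> 'n \<Rightarrow> complex^'n^'n"
  where "matrix_unit j k = (\<chi> r s. if r = j \<and> s = k then 1 else 0)"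

text \<open>
  The three families below are given by definite descriptions; \<open>eta_characterization\<close>,
  \<open>D_fun_characterization\<close> and \<open>G_fun_characterization\<close> show that in each case the
  functional described exists and is unique.
\<close>

definition is_eta :: "complex^'n^'n \<Rightarrow> (('n::finite) unitary_alg \<Rightarrow> complex) \<Rightarrow> bool"
  where "is_eta A f \<longleftrightarrow> linear_functional f \<and> f 1 = 0 \<and> (\<forall>x\<in>ker_counit2. f x = 0) \<and>
    (\<forall>j k. f (uhat j k) = A $ j $ k) \<and>
    (\<forall>j k. f (starU (uhat j k)) = - A $ k $ j)"

definition eta :: "complex^'n^'n \<Rightarrow> ('n::finite) unitary_alg \<Rightarrow> complex"
  where "eta A = (THE f. is_eta A f)"

definition is_D_fun :: "'n \<Rightarrow> 'n \<Rightarrow> (('n::finite) unitary_alg \<Rightarrow> complex) \<Rightarrow> bool"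
  where "is_D_fun j k f \<longleftrightarrow> linear_functional f \<and> f 1 = 0 \<and> (\<forall>x\<in>ker_counit2. f x = 0) \<and>
    (\<forall>r s. f (uhat r s) = (if j = r \<and> k = s then \<i> else 0)) \<and>
    (\<forall>r s. f (starU (uhat r s)) = (if j = s \<and> k = r then - \<i> else 0))"

definition D_fun :: "'n \<Rightarrow> 'n \<Rightarrow> ('n::finite) unitary_alg \<Rightarrow> complex"
  where "D_fun j k = (THE f. is_D_fun j k f)"

definition is_G_fun ::
    "'n \<Rightarrow> 'n \<Rightarrow> 'n \<Rightarrow> 'n \<Rightarrow> (('n::finite) unitary_alg \<Rightarrow> complex) \<Rightarrow> bool"
  where "is_G_fun j k l m f \<longleftrightarrow> linear_functional f \<and> f 1 = 0 \<and>
    (\<forall>r s. f (uhat r s) = - (1/2) * (cadjoint (matrix_unit j k) ** matrix_unit l m) $ r $ s) \<and>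
    (\<forall>r s. f (starU (uhat r s)) = - (1/2) * (cadjoint (matrix_unit j k) ** matrix_unit l m) $ s $ r) \<and>
    (\<forall>x\<in>ker_counit. \<forall>y\<in>ker_counit.
      f (x * y) = cnj (eta (matrix_unit j k) (starU x)) * eta (matrix_unit l m) y)"

definition G_fun :: "'n \<Rightarrow> 'n \<Rightarrow> 'n \<Rightarrow> 'n \<Rightarrow> ('n::finite) unitary_alg \<Rightarrow> complex"
  where "G_fun j k l m = (THE f. is_G_fun j k l m f)"

subsection \<open>Existence and uniqueness\<close>

lemma linear_functional_iff:
  "linear_functional f \<longleftrightarrow> (\<forall>x y. f (x + y) = f x + f y) \<and> (\<forall>c x. f (scaleU c x) = c * f x)"
  unfolding linear_functional_def Vector_Spaces.linear_iff
  using unitary_alg.vector_space_axioms vector_space_over_itself.vector_space_axioms by blast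

lemma linear_functional_diff:
  assumes "linear_functional f"
  shows "f (x - y) = f x - f y"
proof -
  have "f x = f (x - y) + f y"
    using assms by (metis linear_functional_iff diff_add_cancel)
  then show ?thesis by simp
qed

lemma linear_functional_vanish_ker2:
  assumes "linear_functional f" "\<And>a b. counit a = 0 \<Longrightarrow> counit b = 0 \<Longrightarrow> f (a * b) = 0"
    and "x \<in> ker_counit2"
  shows "f x = 0"
proof -
  have "f 0 = 0"
    using linear_functional_diff[OF assms(1), of 0 0] by simp
  from assms(3) show ?thesis
    unfolding ker_counit2_def
  proof (induction rule: unitary_alg.span_induct_alt)
    case base
    show ?case by fact
  next
    case (step c x y)
    then show ?case
      using assms(1,2) by (auto simp: linear_functional_iff ker_counit_def)
  qed
qed

lemma mult_in_ker_counit2: "counit a = 0 \<Longrightarrow> counit b = 0 \<Longrightarrow> a * b \<in> ker_counit2"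
  unfolding ker_counit2_def ker_counit_def by (rule unitary_alg.span_base) blast

lemma scaleU_1_mult: "scaleU c 1 * x = scaleU c x"
  by (simp add: scaleU_mult_left)

lemma mult_scaleU_1: "x * scaleU c 1 = scaleU c x"
  by (simp add: scaleU_mult_right)

lemma linear_functional_eqI:
  assumes f: "linear_functional f" and g: "linear_functional g"
    and one: "f 1 = g 1"
    and u: "\<And>j k. f (uhat j k) = g (uhat j k)"
    and us: "\<And>j k. f (starU (uhat j k)) = g (starU (uhat j k))"
    and mult: "\<And>x y. counit x = 0 \<Longrightarrow> counit y = 0 \<Longrightarrow> f (x * y) = g (x * y)"
  shows "f = g"
proof -
  note lin = f[unfolded linear_functional_iff] g[unfolded linear_functional_iff]
  have zero: "f 0 = 0" "g 0 = 0"
    using linear_functional_diff[OF f, of 0 0] linear_functional_diff[OF g, of 0 0] by simp_all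
  have u': "f (ugen j k) = g (ugen j k)" "f (starU (ugen j k)) = g (starU (ugen j k))" for j k
  proof -
    have starU0: "starU 0 = (0 :: 'a unitary_alg)"
      using starU_diff[of 0 0] by simp
    show "f (ugen j k) = g (ugen j k)"
      using u[of j k] one zero
      by (auto simp: uhat_def linear_functional_diff[OF f] linear_functional_diff[OF g]
          split: if_splits)
    show "f (starU (ugen j k)) = g (starU (ugen j k))"
      using us[of j k] one zero
      by (auto simp: uhat_def starU_diff starU0 linear_functional_diff[OF f]
          linear_functional_diff[OF g] split: if_splits)
  qed
  have letter: "f (abs_unitary_alg (gen a)) = g (abs_unitary_alg (gen a))" for a
    using u' by (cases a) (simp_all add: ugen_def starU.abs_eq)
  have word: "f (abs_unitary_alg (Poly_Mapping.single (Mono as) 1)) =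
      g (abs_unitary_alg (Poly_Mapping.single (Mono as) 1))" for as
  proof (induction as)
    case Nil
    have "abs_unitary_alg (Poly_Mapping.single (Mono []) 1) = (1 :: 'a unitary_alg)"
      by (metis one_unitary_alg_def single_one zero_monomial_def)
    then show ?case using one by simp
  next
    case (Cons a as)
    define x where "x = abs_unitary_alg (gen a)"
    define y where "y = abs_unitary_alg (Poly_Mapping.single (Mono as) 1)"
    define x' where "x' = x - scaleU (counit x) 1"
    define y' where "y' = y - scaleU (counit y) 1"
    have xy: "abs_unitary_alg (Poly_Mapping.single (Mono (a # as)) 1) = x * y"
      by (simp add: x_def y_def times_unitary_alg.abs_eq gen_def mult_single plus_monomial_def)
    have counit: "counit x' = 0" "counit y' = 0"
      by (simp_all add: x'_def y'_def counit_diff counit_scaleU)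
    have eq: "x * y = x' * y' + scaleU (counit x) y + scaleU (counit y) x
        - scaleU (counit x) (scaleU (counit y) 1)"
      by (simp add: x'_def y'_def left_diff_distrib right_diff_distrib scaleU_1_mult mult_scaleU_1
          unitary_alg.scale_right_diff_distrib)
    show ?case
      unfolding xy eq
      using Cons.IH mult[OF counit] letter[of a] one lin
      by (simp add: linear_functional_diff[OF f] linear_functional_diff[OF g] x_def y_def)
  qed
  have "f (abs_unitary_alg p) = g (abs_unitary_alg p)" for p
  proof (induction p rule: free_alg_induct)
    case (single w c)
    have "abs_unitary_alg (Poly_Mapping.single w c) =
        scaleU c (abs_unitary_alg (Poly_Mapping.single (Mono (letters w)) 1))"
      by (simp add: scaleU.abs_eq mult_single)
    then show ?case using lin word[of "letters w"] by simp
  next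
    case (add p q)
    then show ?case using lin by (simp flip: plus_unitary_alg.abs_eq)
  qed
  then have "f x = g x" for x
    by (induction x rule: unitary_alg.abs_induct) simp
  then show ?thesis ..
qed

lemma counit_uhat [simp]: "counit (uhat j k) = 0" "counit (starU (uhat j k)) = 0"
proof -
  have "starU 0 = (0 :: 'a unitary_alg)"
    using starU_diff[of 0 0] by simp
  moreover have "counit (0 :: 'a unitary_alg) = 0"
    using counit_diff[of "0 :: 'a unitary_alg" 0] by simp
  ultimately show "counit (uhat j k) = 0" "counit (starU (uhat j k)) = 0"
    by (simp_all add: uhat_def counit_diff starU_diff)
qed

lemma counit_starU: "counit (starU x) = cnj (counit x)"
proof transfer
  fix p :: "'a free_alg"
  have letter: "counit_letter (letter_star a) = cnj (counit_letter a)" for a :: "'a letter"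
    by (cases a) auto
  have word: "prod_list (map counit_letter (rev (map letter_star as))) =
      cnj (prod_list (map counit_letter as))" for as :: "'a letter list"
    by (induction as) (simp_all add: letter mult.commute)
  show "free_eval counit_letter (free_star p) = cnj (free_eval counit_letter p)"
    by (induction p rule: free_alg_induct)
      (simp_all add: free_eval_def mono_star_def word free_star_add lin_ext_add del: rev_map)
qed

text \<open>
  A pair of \<open>\<epsilon>\<close>-derivations given by their values on letters, and a functional whose
  coboundary is their product; together with the counit they are the entries of a homomorphism
  into upper triangular 3 by 3 matrices.
\<close>

abbreviation counit_word :: "'n letter list \<Rightarrow> complex"
  where "counit_word w \<equiv> prod_list (map counit_letter w)"

primrec deriv_word :: "('n letter \<Rightarrow> complex) \<Rightarrow> 'n letter list \<Rightarrow> complex"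
  where
    "deriv_word \<alpha> [] = 0"
  | "deriv_word \<alpha> (a # w) = \<alpha> a * counit_word w + counit_letter a * deriv_word \<alpha> w"

primrec tri_word ::
    "('n letter \<Rightarrow> complex) \<Rightarrow> ('n letter \<Rightarrow> complex) \<Rightarrow> ('n letter \<Rightarrow> complex) \<Rightarrow> 'n letter list \<Rightarrow> complex"
  where
    "tri_word \<alpha> \<beta> \<gamma> [] = 0"
  | "tri_word \<alpha> \<beta> \<gamma> (a # w) =
      \<gamma> a * counit_word w + \<alpha> a * deriv_word \<beta> w + counit_letter a * tri_word \<alpha> \<beta> \<gamma> w"

lemma deriv_word_append:
  "deriv_word \<alpha> (v @ w) = deriv_word \<alpha> v * counit_word w + counit_word v * deriv_word \<alpha> w"
  by (induction v) (simp_all add: algebra_simps)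

lemma tri_word_append:
  "tri_word \<alpha> \<beta> \<gamma> (v @ w) =
    tri_word \<alpha> \<beta> \<gamma> v * counit_word w + deriv_word \<alpha> v * deriv_word \<beta> w + counit_word v * tri_word \<alpha> \<beta> \<gamma> w"
  by (induction v) (simp_all add: deriv_word_append algebra_simps)

definition free_deriv :: "('n letter \<Rightarrow> complex) \<Rightarrow> 'n free_alg \<Rightarrow> complex"
  where "free_deriv \<alpha> = lin_ext (\<lambda>w. deriv_word \<alpha> (letters w))"

definition free_tri ::
    "('n letter \<Rightarrow> complex) \<Rightarrow> ('n letter \<Rightarrow> complex) \<Rightarrow> ('n letter \<Rightarrow> complex) \<Rightarrow> 'n free_alg \<Rightarrow> complex"
  where "free_tri \<alpha> \<beta> \<gamma> = lin_ext (\<lambda>w. tri_word \<alpha> \<beta> \<gamma> (letters w))"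

lemma free_deriv_mult:
  "free_deriv \<alpha> (p * q) =
    free_deriv \<alpha> p * free_eval counit_letter q + free_eval counit_letter p * free_deriv \<alpha> q"
proof (induction p rule: free_alg_induct)
  case (single v c)
  show ?case
    by (induction q rule: free_alg_induct)
      (simp_all add: free_eval_def free_deriv_def mult_single plus_monomial_def deriv_word_append
        lin_ext_add algebra_simps)
qed (simp add: free_eval_def free_deriv_def lin_ext_add algebra_simps)

lemma free_tri_mult:
  "free_tri \<alpha> \<beta> \<gamma> (p * q) =
    free_tri \<alpha> \<beta> \<gamma> p * free_eval counit_letter q + free_deriv \<alpha> p * free_deriv \<beta> q
      + free_eval counit_letter p * free_tri \<alpha> \<beta> \<gamma> q"
proof (induction p rule: free_alg_induct)
  case (single v c)
  show ?case
    by (induction q rule: free_alg_induct)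
      (simp_all add: free_eval_def free_deriv_def free_tri_def mult_single plus_monomial_def
        tri_word_append lin_ext_add algebra_simps)
qed (simp add: free_eval_def free_deriv_def free_tri_def lin_ext_add algebra_simps)

fun eta_letter :: "complex^'n^'n \<Rightarrow> 'n letter \<Rightarrow> complex"
  where
    "eta_letter A (U j k) = A $ j $ k"
  | "eta_letter A (Us j k) = - A $ k $ j"

fun gauss_letter :: "complex^'n^'n \<Rightarrow> 'n letter \<Rightarrow> complex"
  where
    "gauss_letter C (U j k) = - (1/2) * C $ j $ k"
  | "gauss_letter C (Us j k) = - (1/2) * C $ k $ j"

lemma free_deriv_relator:
  assumes "r \<in> relators"
  shows "free_deriv (eta_letter A) r = 0"
  using assms
proof (cases rule: relatorsE)
  case (1 k l)
  have "free_deriv (eta_letter A) (if k = l then 1 else 0) = 0"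
    by (simp add: free_deriv_def zero_monomial_def)
  moreover have "free_deriv (eta_letter A) (\<Sum>j\<in>UNIV. gen (U k j) * gen (Us l j)) = 0"
    by (simp add: free_deriv_def lin_ext_sum gen_def mult_single plus_monomial_def sum.distrib
        sum_subtractf if_distrib[where f = "\<lambda>c. c * _"] if_distrib[where f = "\<lambda>c. _ * c"] cong: if_cong)
  ultimately show ?thesis
    by (simp add: 1 free_deriv_def lin_ext_diff)
next
  case (2 k l)
  have "free_deriv (eta_letter A) (if k = l then 1 else 0) = 0"
    by (simp add: free_deriv_def zero_monomial_def)
  moreover have "free_deriv (eta_letter A) (\<Sum>j\<in>UNIV. gen (Us j k) * gen (U j l)) = 0"
    by (simp add: free_deriv_def lin_ext_sum gen_def mult_single plus_monomial_def sum.distrib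
        sum_subtractf if_distrib[where f = "\<lambda>c. c * _"] if_distrib[where f = "\<lambda>c. _ * c"] cong: if_cong)
  ultimately show ?thesis
    by (simp add: 2 free_deriv_def lin_ext_diff)
qed

lemma free_tri_relator:
  assumes "r \<in> relators"
  shows "free_tri (eta_letter (- cadjoint A)) (eta_letter B) (gauss_letter (cadjoint A ** B)) r = 0"
    (is "?T r = 0")
  using assms
proof (cases rule: relatorsE)
  case (1 k l)
  have "?T (if k = l then 1 else 0) = 0"
    by (simp add: free_tri_def zero_monomial_def)
  moreover have "?T (\<Sum>j\<in>UNIV. gen (U k j) * gen (Us l j)) = 0"
    by (simp add: free_tri_def lin_ext_sum gen_def mult_single plus_monomial_def sum.distrib
        sum_subtractf matrix_matrix_mult_def cadjoint_def sum_negf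
        if_distrib[where f = "\<lambda>c. c * _"] if_distrib[where f = "\<lambda>c. c / _"]
        if_distrib[where f = "\<lambda>c. _ * c"] cong: if_cong)
  ultimately show ?thesis
    by (simp add: 1 free_tri_def lin_ext_diff)
next
  case (2 k l)
  have "?T (if k = l then 1 else 0) = 0"
    by (simp add: free_tri_def zero_monomial_def)
  moreover have "?T (\<Sum>j\<in>UNIV. gen (Us j k) * gen (U j l)) = 0"
    by (simp add: free_tri_def lin_ext_sum gen_def mult_single plus_monomial_def sum.distrib
        sum_subtractf matrix_matrix_mult_def cadjoint_def sum_negf
        if_distrib[where f = "\<lambda>c. c * _"] if_distrib[where f = "\<lambda>c. c / _"]
        if_distrib[where f = "\<lambda>c. _ * c"] cong: if_cong)
  ultimately show ?thesis
    by (simp add: 2 free_tri_def lin_ext_diff)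
qed

lemma free_deriv_ideal: "x \<in> rel_ideal \<Longrightarrow> free_deriv (eta_letter A) x = 0"
proof (induction rule: rel_ideal.induct)
  case zero
  show ?case by (simp add: free_deriv_def)
next
  case (relator r a b)
  then show ?case
    by (simp add: free_deriv_mult free_deriv_relator relators_counit free_eval_mult)
next
  case (add x y)
  then show ?case by (simp add: free_deriv_def lin_ext_add)
qed

lemma free_tri_ideal:
  "x \<in> rel_ideal \<Longrightarrow>
    free_tri (eta_letter (- cadjoint A)) (eta_letter B) (gauss_letter (cadjoint A ** B)) x = 0"
proof (induction rule: rel_ideal.induct)
  case zero
  show ?case by (simp add: free_tri_def)
next
  case (relator r a b)
  then show ?case
    by (simp add: free_tri_mult free_tri_relator free_deriv_mult free_deriv_relator
        relators_counit free_eval_mult)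
next
  case (add x y)
  then show ?case by (simp add: free_tri_def lin_ext_add)
qed

lift_definition deriv_fun :: "complex^'n^'n \<Rightarrow> ('n::finite) unitary_alg \<Rightarrow> complex"
  is "\<lambda>A. free_deriv (eta_letter A)"
proof -
  fix A :: "complex^'n^'n" and p q :: "'n free_alg"
  assume "rel_cong p q"
  then have "free_deriv (eta_letter A) (p - q) = 0"
    unfolding rel_cong_def by (rule free_deriv_ideal)
  then show "free_deriv (eta_letter A) p = free_deriv (eta_letter A) q"
    by (simp add: free_deriv_def lin_ext_diff)
qed

lift_definition tri_fun ::
    "complex^'n^'n \<Rightarrow> complex^'n^'n \<Rightarrow> ('n::finite) unitary_alg \<Rightarrow> complex"
  is "\<lambda>A B. free_tri (eta_letter (- cadjoint A)) (eta_letter B) (gauss_letter (cadjoint A ** B))"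
proof -
  fix A B :: "complex^'n^'n" and p q :: "'n free_alg"
  let ?T = "free_tri (eta_letter (- cadjoint A)) (eta_letter B) (gauss_letter (cadjoint A ** B))"
  assume "rel_cong p q"
  then have "?T (p - q) = 0"
    unfolding rel_cong_def by (rule free_tri_ideal)
  then show "?T p = ?T q"
    by (simp add: free_tri_def lin_ext_diff)
qed

lemma deriv_fun_linear: "linear_functional (deriv_fun A)"
  unfolding linear_functional_iff
  by (intro conjI allI; transfer; simp add: free_deriv_def lin_ext_add lin_ext_const_mult)

lemma tri_fun_linear: "linear_functional (tri_fun A B)"
  unfolding linear_functional_iff
  by (intro conjI allI; transfer; simp add: free_tri_def lin_ext_add lin_ext_const_mult)

lemma deriv_fun_1 [simp]: "deriv_fun A 1 = 0"
  by transfer (simp add: free_deriv_def zero_monomial_def)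

lemma tri_fun_1 [simp]: "tri_fun A B 1 = 0"
  by transfer (simp add: free_tri_def zero_monomial_def)

lemma deriv_fun_mult:
  "deriv_fun A (x * y) = deriv_fun A x * counit y + counit x * deriv_fun A y"
  by transfer (rule free_deriv_mult)

lemma tri_fun_mult:
  "tri_fun A B (x * y) =
    tri_fun A B x * counit y + deriv_fun (- cadjoint A) x * deriv_fun B y + counit x * tri_fun A B y"
  by transfer (rule free_tri_mult)

lemma starU_0 [simp]: "starU 0 = 0"
  using starU_diff[of 0 0] by simp

lemma linear_functional_0: "linear_functional f \<Longrightarrow> f 0 = 0"
  using linear_functional_diff[of f 0 0] by simp

lemma linear_functional_uhat:
  assumes "linear_functional f" "f 1 = 0"
  shows "f (uhat j k) = f (ugen j k)" "f (starU (uhat j k)) = f (starU (ugen j k))"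
  using assms by (simp_all add: uhat_def starU_diff linear_functional_diff linear_functional_0)

lemma deriv_fun_uhat [simp]:
  "deriv_fun A (uhat j k) = A $ j $ k"
  "deriv_fun A (starU (uhat j k)) = - A $ k $ j"
  unfolding linear_functional_uhat[OF deriv_fun_linear deriv_fun_1]
  by (transfer; simp add: free_deriv_def)+

lemma tri_fun_uhat [simp]:
  "tri_fun A B (uhat j k) = - (1/2) * (cadjoint A ** B) $ j $ k"
  "tri_fun A B (starU (uhat j k)) = - (1/2) * (cadjoint A ** B) $ k $ j"
  unfolding linear_functional_uhat[OF tri_fun_linear tri_fun_1]
  by (transfer; simp add: free_tri_def)+

lemma vanish_ker2_iff:
  assumes "linear_functional f"
  shows "(\<forall>x\<in>ker_counit2. f x = 0) \<longleftrightarrow> (\<forall>a b. counit a = 0 \<longrightarrow> counit b = 0 \<longrightarrow> f (a * b) = 0)"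
  using linear_functional_vanish_ker2[OF assms] mult_in_ker_counit2 by blast

lemma is_eta_deriv_fun: "is_eta A (deriv_fun A)"
  by (simp add: is_eta_def vanish_ker2_iff deriv_fun_linear deriv_fun_mult)

lemma is_eta_unique: "is_eta A f \<Longrightarrow> is_eta A g \<Longrightarrow> f = g"
  by (rule linear_functional_eqI) (simp_all add: is_eta_def mult_in_ker_counit2)

lemma eta_eq: "eta A = deriv_fun A"
  unfolding eta_def
  by (rule the_equality) (use is_eta_deriv_fun is_eta_unique in blast)+

theorem eta_characterization: "is_eta A f \<longleftrightarrow> f = eta A"
  using is_eta_deriv_fun is_eta_unique eta_eq by metis

lemma is_D_fun_iff: "is_D_fun j k f \<longleftrightarrow> is_eta (\<chi> r s. if j = r \<and> k = s then \<i> else 0) f"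
  unfolding is_D_fun_def is_eta_def by (auto simp: if_distrib[where f = uminus] cong: if_cong)

theorem D_fun_characterization: "is_D_fun j k f \<longleftrightarrow> f = D_fun j k"
  unfolding D_fun_def is_D_fun_iff eta_characterization by simp

lemma cnj_eta_starU: "cnj (eta A (starU x)) = deriv_fun (- cadjoint A) x"
proof -
  have "(\<lambda>x. cnj (eta A (starU x))) = deriv_fun (- cadjoint A)"
  proof (rule linear_functional_eqI)
    show "linear_functional (\<lambda>x. cnj (eta A (starU x)))"
      using deriv_fun_linear[of A]
      by (simp add: linear_functional_iff eta_eq starU_add starU_scaleU)
  qed (simp_all add: deriv_fun_linear eta_eq starU_mult deriv_fun_mult counit_starU cadjoint_def)
  then show ?thesis by metis
qed

theorem G_fun_characterization: "is_G_fun j k l m f \<longleftrightarrow> f = G_fun j k l m"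
proof -
  let ?G = "tri_fun (matrix_unit j k) (matrix_unit l m)"
  have ex: "is_G_fun j k l m ?G"
    by (simp add: is_G_fun_def tri_fun_linear tri_fun_mult cnj_eta_starU[unfolded eta_eq] eta_eq ker_counit_def)
  have unique: "f = ?G" if "is_G_fun j k l m f" for f
    using that ex by (intro linear_functional_eqI) (simp_all add: is_G_fun_def ker_counit_def)
  have "G_fun j k l m = ?G"
    unfolding G_fun_def using ex unique by (rule the_equality)
  then show ?thesis
    using ex unique by metis
qed

end

(* The sesquilinear form (x, y) \<mapsto> L (x* y) of a Gaussian generator on K depends only on the classes
   of x and y modulo K^2. Unitarity makes u_lk-hat* + u_kl-hat an element of K^2, so K / K^2 is spanned by
   the u_lm-hat, with coordinates given by the eta-functionals. Hence the form is determined by the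
   Gram matrix sigma_(jk,lm) = L (u_jk-hat* u_lm-hat), and L minus the sigma-combination of the
   G-functionals is a hermitian functional that vanishes on K^2, i.e. a combination of the
   D-functionals with hermitian coefficients. *)

theory Submission
  imports Defs
begin

section \<open>Linear functionals, involution and counit on finite sums\<close>

lemma linear_functional_sum:
  assumes "linear_functional f"
  shows "f (\<Sum>i\<in>A. g i) = (\<Sum>i\<in>A. f (g i))"
  using assms
  by (induction A rule: infinite_finite_induct)
    (simp_all add: linear_functional_iff linear_functional_0)

lemma linear_functional_minus:
  assumes "linear_functional f" "linear_functional g"
  shows "linear_functional (\<lambda>x. f x - g x)"
  using assms by (simp add: linear_functional_iff algebra_simps)

lemma starU_sum: "starU (\<Sum>i\<in>A. g i) = (\<Sum>i\<in>A. starU (g i))"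
  by (induction A rule: infinite_finite_induct) (simp_all add: starU_add)

lemma counit_0 [simp]: "counit 0 = 0"
  using counit_diff[of 0 0] by simp

lemma counit_sum: "counit (\<Sum>i\<in>A. g i) = (\<Sum>i\<in>A. counit (g i))"
  by (induction A rule: infinite_finite_induct) (simp_all add: counit_add)

text \<open>Substitute u = uhat + 1 into the unitarity relation between rows \<open>k\<close> and
  \<open>l\<close>. The remaining sum lies in K^2, so modulo K^2 the star of a \<open>uhat\<close>
  is minus the \<open>uhat\<close> with transposed indices.\<close>

lemma uhat_relation:
  "starU (uhat l k) = - uhat k l - (\<Sum>j\<in>UNIV. uhat k j * starU (uhat l j))"
proof -
  have u: "ugen k j = uhat k j + (if k = j then 1 else 0)"
    and us: "starU (ugen l j) = starU (uhat l j) + (if l = j then 1 else 0)" for j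
    by (auto simp: uhat_def starU_diff)
  have "(\<Sum>j\<in>UNIV. ugen k j * starU (ugen l j)) =
      (\<Sum>j\<in>UNIV. uhat k j * starU (uhat l j)) + uhat k l + starU (uhat l k) + (if k = l then 1 else 0)"
    by (simp add: u us distrib_left distrib_right sum.distrib if_distrib[where f = "\<lambda>c. c * _"]
        if_distrib[where f = "\<lambda>c. _ * c"] add.assoc cong: if_cong)
  then show ?thesis
    by (simp add: ugen_relations(1) algebra_simps eq_neg_iff_add_eq_0)
qed

lemma linear_functional_star_uhat:
  assumes f: "linear_functional f"
    and mult: "\<And>a b. counit a = 0 \<Longrightarrow> counit b = 0 \<Longrightarrow> f (a * b) = 0"
  shows "f (starU (uhat l k)) = - f (uhat k l)"
proof -
  \<comment> \<open>The negative is written as a difference from 0 so that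
    \<open>linear_functional_diff\<close> evaluates it.\<close>
  have "f (starU (uhat l k)) = f (0 - uhat k l - (\<Sum>j\<in>UNIV. uhat k j * starU (uhat l j)))"
    by (subst uhat_relation) simp
  also have "\<dots> = - f (uhat k l)"
    by (simp add: linear_functional_diff[OF f] linear_functional_0[OF f]
        linear_functional_sum[OF f] mult del: diff_0)
  finally show ?thesis .
qed

section \<open>Matrix units and coordinates on K / K^2\<close>

lemma sum_matrix_unit:
  "(\<Sum>l\<in>UNIV. \<Sum>m\<in>UNIV. g l m * matrix_unit l m $ r $ s) = (g r s :: complex)"
proof -
  have "g l m * matrix_unit l m $ r $ s = (if r = l then if s = m then g l m else 0 else 0)" for l m
    by (simp add: matrix_unit_def)
  then have "(\<Sum>m\<in>UNIV. g l m * matrix_unit l m $ r $ s) = (if r = l then g l s else 0)" for l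
    by (cases "r = l") simp_all
  then show ?thesis
    by simp
qed

lemma cnj_matrix_unit: "cnj (matrix_unit j k $ r $ s) = matrix_unit j k $ r $ s"
  by (simp add: matrix_unit_def)

lemma cadjoint_matrix_unit_mult:
  "(cadjoint (matrix_unit j k) ** matrix_unit l m) $ r $ s = (if j = l \<and> r = k \<and> s = m then 1 else 0)"
proof -
  \<comment> \<open>Row \<open>j\<close> is the only nonzero row of \<open>matrix_unit j k\<close>,
    so one summand survives: the product is E_km if \<open>j = l\<close>, and 0 otherwise.\<close>
  have "(cadjoint (matrix_unit j k) ** matrix_unit l m) $ r $ s
      = (\<Sum>i\<in>UNIV. if i = j then if j = l \<and> r = k \<and> s = m then 1 else 0 else 0)"
    unfolding matrix_matrix_mult_def cadjoint_def matrix_unit_def vec_lambda_beta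
    by (rule sum.cong) auto
  then show ?thesis
    by simp
qed

lemma linear_functional_eta: "linear_functional (eta A)"
  by (simp add: eta_eq deriv_fun_linear)

lemma eta_simps [simp]:
  "eta A 1 = 0"
  "eta A (uhat j k) = A $ j $ k"
  "eta A (starU (uhat j k)) = - A $ k $ j"
  "counit x = 0 \<Longrightarrow> counit y = 0 \<Longrightarrow> eta A (x * y) = 0"
  by (simp_all add: eta_eq deriv_fun_mult)

lemma linear_functional_scale:
  "linear_functional f \<Longrightarrow> linear_functional (\<lambda>x. c * f x)"
  by (simp add: linear_functional_iff algebra_simps)

lemma linear_functional_sum_fun:
  "(\<And>i. linear_functional (f i)) \<Longrightarrow> linear_functional (\<lambda>x. \<Sum>i\<in>A. f i x)"
  by (simp add: linear_functional_iff sum.distrib sum_distrib_left)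

text \<open>Such an \<open>f\<close> is determined by its values on the \<open>uhat l m\<close>, and
  the functionals \<open>eta (matrix_unit l m)\<close> are dual to these elements. On the stars both
  sides agree because each changes sign and transposes the indices.\<close>

lemma vanish_on_products_eq_eta:
  fixes f :: "('n::finite) unitary_alg \<Rightarrow> complex"
  assumes f: "linear_functional f" and one: "f 1 = 0"
    and mult: "\<And>a b. counit a = 0 \<Longrightarrow> counit b = 0 \<Longrightarrow> f (a * b) = 0"
  shows "f y = (\<Sum>l\<in>UNIV. \<Sum>m\<in>UNIV. f (uhat l m) * eta (matrix_unit l m) y)"
proof -
  have "f = (\<lambda>y. \<Sum>l\<in>UNIV. \<Sum>m\<in>UNIV. f (uhat l m) * eta (matrix_unit l m) y)"
  proof (rule linear_functional_eqI[OF f])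
    show "linear_functional (\<lambda>y. \<Sum>l\<in>UNIV. \<Sum>m\<in>UNIV. f (uhat l m) * eta (matrix_unit l m) y)"
      by (intro linear_functional_sum_fun linear_functional_scale linear_functional_eta)
  qed (simp_all add: one mult sum_matrix_unit sum_negf linear_functional_star_uhat[OF f mult])
  then show ?thesis by metis
qed

section \<open>The values of a Gaussian generator on products\<close>

lemma gaussian_mult_right:
  fixes L :: "('n::finite) unitary_alg \<Rightarrow> complex"
  assumes L: "linear_functional L"
    and cubic: "\<And>a b c. counit a = 0 \<Longrightarrow> counit b = 0 \<Longrightarrow> counit c = 0 \<Longrightarrow> L (a * b * c) = 0"
    and x: "counit x = 0" and y: "counit y = 0"
  shows "L (x * y) = (\<Sum>l\<in>UNIV. \<Sum>m\<in>UNIV. L (x * uhat l m) * eta (matrix_unit l m) y)"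
proof -
  \<comment> \<open>Projecting \<open>z\<close> to K makes \<open>f\<close> vanish at 1, while
    \<open>f z\<close> is still \<open>L (x * z)\<close> for \<open>z\<close> in K. On a product of
    two elements of K it is a value of \<open>L\<close> on K^3, hence 0.\<close>
  define f where "f z = L (x * (z - scaleU (counit z) 1))" for z
  have eq: "f z = L (x * z) - counit z * L x" for z
    using L by (simp add: f_def right_diff_distrib linear_functional_diff mult_scaleU_1
        linear_functional_iff)
  have lin: "linear_functional f"
    using L by (simp add: eq linear_functional_iff distrib_left counit_add counit_scaleU
        scaleU_mult_right algebra_simps)
  have mult: "f (a * b) = 0" if "counit a = 0" "counit b = 0" for a b
    using cubic[OF x that] that by (simp add: eq counit_mult mult.assoc)
  have "f y = (\<Sum>l\<in>UNIV. \<Sum>m\<in>UNIV. f (uhat l m) * eta (matrix_unit l m) y)"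
  proof (rule vanish_on_products_eq_eta[OF lin])
    show "f 1 = 0"
      by (simp add: eq)
  qed (rule mult)
  then show ?thesis
    by (simp add: eq y)
qed

lemma gaussian_mult:
  fixes L :: "('n::finite) unitary_alg \<Rightarrow> complex"
  assumes "gaussian L" and x: "counit x = 0" and y: "counit y = 0"
  shows "L (x * y) = (\<Sum>j\<in>UNIV. \<Sum>k\<in>UNIV. \<Sum>l\<in>UNIV. \<Sum>m\<in>UNIV. L (starU (uhat j k) * uhat l m) *
    (cnj (eta (matrix_unit j k) (starU x)) * eta (matrix_unit l m) y))"
proof -
  have L: "linear_functional L" and star: "L (starU z) = cnj (L z)" for z
    using assms(1) by (auto simp: gaussian_def generator_def)
  have cubic: "L (a * b * c) = 0" if "counit a = 0" "counit b = 0" "counit c = 0" for a b c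
  proof -
    have "a * b * c \<in> ker_counit3"
      unfolding ker_counit3_def ker_counit_def using that by (intro unitary_alg.span_base) blast
    then show ?thesis using assms(1) by (simp add: gaussian_def)
  qed
  \<comment> \<open>The involution brings \<open>x\<close> to the right, where
    \<open>gaussian_mult_right\<close> can expand it. Undoing the conjugation puts \<open>y\<close>
    back on the right for a second expansion.\<close>
  have "L (x * y) = cnj (L (starU y * starU x))"
    by (simp add: star flip: starU_mult)
  also have "L (starU y * starU x) =
      (\<Sum>j\<in>UNIV. \<Sum>k\<in>UNIV. L (starU y * uhat j k) * eta (matrix_unit j k) (starU x))"
    by (rule gaussian_mult_right[OF L cubic]) (simp_all add: x y counit_starU)
  also have "cnj \<dots> = (\<Sum>j\<in>UNIV. \<Sum>k\<in>UNIV. L (starU (uhat j k) * y) * cnj (eta (matrix_unit j k) (starU x)))"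
    by (simp add: starU_mult flip: star)
  also have "\<dots> = (\<Sum>j\<in>UNIV. \<Sum>k\<in>UNIV. (\<Sum>l\<in>UNIV. \<Sum>m\<in>UNIV.
      L (starU (uhat j k) * uhat l m) * eta (matrix_unit l m) y) * cnj (eta (matrix_unit j k) (starU x)))"
    by (subst gaussian_mult_right[OF L cubic _ y]) simp_all
  finally show ?thesis
    by (simp only: sum_distrib_left sum_distrib_right mult_ac)
qed

section \<open>Linear combinations of the basic functionals\<close>

definition gauss_sum :: "complex^('n \<times> 'n)^('n \<times> 'n) \<Rightarrow> ('n::finite) unitary_alg \<Rightarrow> complex"
  where "gauss_sum \<sigma> x =
    (\<Sum>j\<in>UNIV. \<Sum>k\<in>UNIV. \<Sum>l\<in>UNIV. \<Sum>m\<in>UNIV. \<sigma> $ (j, k) $ (l, m) * G_fun j k l m x)"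

definition drift_sum :: "complex^'n^'n \<Rightarrow> ('n::finite) unitary_alg \<Rightarrow> complex"
  where "drift_sum b x = (\<Sum>j\<in>UNIV. \<Sum>k\<in>UNIV. b $ j $ k * D_fun j k x)"

lemma
  shows linear_functional_G_fun: "linear_functional (G_fun j k l m)"
    and G_fun_1: "G_fun j k l m 1 = 0"
    and G_fun_uhat:
      "G_fun j k l m (uhat r s) = - (1/2) * (cadjoint (matrix_unit j k) ** matrix_unit l m) $ r $ s"
    and G_fun_star_uhat:
      "G_fun j k l m (starU (uhat r s)) =
        - (1/2) * (cadjoint (matrix_unit j k) ** matrix_unit l m) $ s $ r"
    and G_fun_mult: "counit x = 0 \<Longrightarrow> counit y = 0 \<Longrightarrow> G_fun j k l m (x * y) =
      cnj (eta (matrix_unit j k) (starU x)) * eta (matrix_unit l m) y"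
proof -
  have "is_G_fun j k l m (G_fun j k l m)"
    by (simp add: G_fun_characterization)
  note G = this[unfolded is_G_fun_def ker_counit_def mem_Collect_eq Ball_def]
  show "linear_functional (G_fun j k l m)"
    and "G_fun j k l m 1 = 0"
    and "G_fun j k l m (uhat r s) = - (1/2) * (cadjoint (matrix_unit j k) ** matrix_unit l m) $ r $ s"
    and "G_fun j k l m (starU (uhat r s)) =
      - (1/2) * (cadjoint (matrix_unit j k) ** matrix_unit l m) $ s $ r"
    and "counit x = 0 \<Longrightarrow> counit y = 0 \<Longrightarrow> G_fun j k l m (x * y) =
      cnj (eta (matrix_unit j k) (starU x)) * eta (matrix_unit l m) y"
    using G by blast+
qed

lemma
  shows linear_functional_D_fun: "linear_functional (D_fun j k)"
    and D_fun_1: "D_fun j k 1 = 0"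
    and D_fun_uhat: "D_fun j k (uhat r s) = \<i> * matrix_unit j k $ r $ s"
    and D_fun_star_uhat: "D_fun j k (starU (uhat r s)) = - \<i> * matrix_unit j k $ s $ r"
    and D_fun_mult: "counit x = 0 \<Longrightarrow> counit y = 0 \<Longrightarrow> D_fun j k (x * y) = 0"
  \<comment> \<open>The Kronecker deltas are turned into entries of \<open>matrix_unit j k\<close>,
    the shape that \<open>sum_matrix_unit\<close> collapses.\<close>
  using D_fun_characterization[of j k "D_fun j k"]
  by (auto simp: is_D_fun_def matrix_unit_def mult_in_ker_counit2)

lemma linear_functional_gauss_sum: "linear_functional (gauss_sum \<sigma>)"
  unfolding gauss_sum_def[abs_def]
  by (intro linear_functional_sum_fun linear_functional_scale linear_functional_G_fun)

lemma linear_functional_drift_sum: "linear_functional (drift_sum b)"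
  unfolding drift_sum_def[abs_def]
  by (intro linear_functional_sum_fun linear_functional_scale linear_functional_D_fun)

lemma gauss_sum_1: "gauss_sum \<sigma> 1 = 0"
  by (simp add: gauss_sum_def G_fun_1)

lemma drift_sum_1: "drift_sum b 1 = 0"
  by (simp add: drift_sum_def D_fun_1)

lemma gauss_sum_mult:
  assumes "counit x = 0" "counit y = 0"
  shows "gauss_sum \<sigma> (x * y) = (\<Sum>j\<in>UNIV. \<Sum>k\<in>UNIV. \<Sum>l\<in>UNIV. \<Sum>m\<in>UNIV. \<sigma> $ (j, k) $ (l, m) *
    (cnj (eta (matrix_unit j k) (starU x)) * eta (matrix_unit l m) y))"
  by (simp add: gauss_sum_def G_fun_mult assms)

text \<open>The eta-functionals act on the \<open>uhat\<close> as Kronecker deltas, so these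
  products recover the coefficients. Since \<open>drift_sum\<close> vanishes on them, \<sigma> can
  be read off the whole combination.\<close>

lemma gauss_sum_star_uhat_mult_uhat:
  "gauss_sum \<sigma> (starU (uhat j k) * uhat l m) = \<sigma> $ (j, k) $ (l, m)"
proof -
  \<comment> \<open>The sums are nested so that \<open>sum_matrix_unit\<close> applies first to the
    inner pair of indices and then to the outer pair.\<close>
  have "gauss_sum \<sigma> (starU (uhat j k) * uhat l m) =
      (\<Sum>j'\<in>UNIV. \<Sum>k'\<in>UNIV. (\<Sum>l'\<in>UNIV. \<Sum>m'\<in>UNIV. \<sigma> $ (j', k') $ (l', m') *
        matrix_unit l' m' $ l $ m) * matrix_unit j' k' $ j $ k)"
    by (simp add: gauss_sum_mult cnj_matrix_unit sum_distrib_left sum_distrib_right mult_ac)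
  then show ?thesis by (simp only: sum_matrix_unit)
qed

lemma drift_sum_mult: "counit x = 0 \<Longrightarrow> counit y = 0 \<Longrightarrow> drift_sum b (x * y) = 0"
  by (simp add: drift_sum_def D_fun_mult)

lemma drift_sum_uhat:
  "drift_sum b (uhat r s) = \<i> * b $ r $ s"
  "drift_sum b (starU (uhat r s)) = - \<i> * b $ s $ r"
proof -
  \<comment> \<open>Isolates the matrix-unit entry \<open>z\<close> as the last factor, as
    \<open>sum_matrix_unit\<close> requires.\<close>
  have *: "b $ j $ k * (c * z) = c * b $ j $ k * z" for c z :: complex and j k
    by (rule mult.left_commute[THEN trans]) (rule mult.assoc[symmetric])
  show "drift_sum b (uhat r s) = \<i> * b $ r $ s"
    "drift_sum b (starU (uhat r s)) = - \<i> * b $ s $ r"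
    unfolding drift_sum_def D_fun_uhat D_fun_star_uhat * sum_matrix_unit by simp_all
qed

lemma sum_swap_pairs:
  "(\<Sum>j\<in>A. \<Sum>k\<in>B. \<Sum>l\<in>C. \<Sum>m\<in>D. f j k l m) = (\<Sum>l\<in>C. \<Sum>m\<in>D. \<Sum>j\<in>A. \<Sum>k\<in>B. f j k l m)"
proof -
  have "(\<Sum>j\<in>A. \<Sum>k\<in>B. \<Sum>l\<in>C. \<Sum>m\<in>D. f j k l m) = (\<Sum>j\<in>A. \<Sum>l\<in>C. \<Sum>k\<in>B. \<Sum>m\<in>D. f j k l m)"
    by (intro sum.cong refl sum.swap)
  also have "\<dots> = (\<Sum>l\<in>C. \<Sum>j\<in>A. \<Sum>m\<in>D. \<Sum>k\<in>B. f j k l m)"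
    by (subst sum.swap) (intro sum.cong refl sum.swap)
  also have "\<dots> = (\<Sum>l\<in>C. \<Sum>m\<in>D. \<Sum>j\<in>A. \<Sum>k\<in>B. f j k l m)"
    by (intro sum.cong refl sum.swap)
  finally show ?thesis .
qed

lemma gauss_sum_star_uhat:
  assumes "\<And>j k l m. cnj (\<sigma> $ (j, k) $ (l, m)) = \<sigma> $ (l, m) $ (j, k)"
  shows "gauss_sum \<sigma> (starU (uhat r s)) = cnj (gauss_sum \<sigma> (uhat r s))"
proof -
  \<comment> \<open>The adjoint of E_jk^* E_lm is E_lm^* E_jk, so conjugation exchanges the two
    index pairs; hermitian symmetry of \<sigma> then compensates for the exchange.\<close>
  have G: "G_fun j k l m (starU (uhat r s)) = cnj (G_fun l m j k (uhat r s))" for j k l m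
    by (auto simp: G_fun_uhat G_fun_star_uhat cadjoint_matrix_unit_mult)
  have "gauss_sum \<sigma> (starU (uhat r s)) = (\<Sum>j\<in>UNIV. \<Sum>k\<in>UNIV. \<Sum>l\<in>UNIV. \<Sum>m\<in>UNIV.
      \<sigma> $ (j, k) $ (l, m) * cnj (G_fun l m j k (uhat r s)))"
    by (simp add: gauss_sum_def G)
  also have "\<dots> = (\<Sum>l\<in>UNIV. \<Sum>m\<in>UNIV. \<Sum>j\<in>UNIV. \<Sum>k\<in>UNIV.
      \<sigma> $ (j, k) $ (l, m) * cnj (G_fun l m j k (uhat r s)))"
    by (rule sum_swap_pairs)
  also have "\<dots> = cnj (gauss_sum \<sigma> (uhat r s))"
    by (simp add: gauss_sum_def assms)
  finally show ?thesis .
qed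

section \<open>Decomposition of Gaussian generators and the drift criterion\<close>

lemma gram_matrix_pos_semidef:
  fixes L :: "('n::finite) unitary_alg \<Rightarrow> complex" and u :: "'m::finite \<Rightarrow> 'n unitary_alg"
  assumes "generator L" and "\<And>i. counit (u i) = 0"
  shows "pos_semidef_matrix (\<chi> i j. L (starU (u i) * u j))"
  unfolding pos_semidef_matrix_def
proof
  fix v :: "complex^'m"
  \<comment> \<open>The quadratic form of the Gram matrix at \<open>v\<close> is
    \<open>L (starU b * b)\<close> for this element of K.\<close>
  define b where "b = (\<Sum>i\<in>UNIV. scaleU (v $ i) (u i))"
  have L: "linear_functional L" and scale: "L (scaleU c x) = c * L x" for c x
    using assms(1) by (auto simp: generator_def linear_functional_iff)
  have "counit b = 0"
    by (simp add: b_def counit_sum counit_scaleU assms(2))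
  then have "L (starU b * b) \<in> \<real>\<^sub>\<ge>\<^sub>0"
    using assms(1) by (simp add: generator_def)
  also have "L (starU b * b) = (\<Sum>i\<in>UNIV. \<Sum>j\<in>UNIV. cnj (v $ i) * L (starU (u i) * u j) * v $ j)"
    by (simp add: b_def starU_sum starU_scaleU sum_product linear_functional_sum[OF L]
        scaleU_mult_left scaleU_mult_right scale mult_ac)
  finally show "(\<Sum>i\<in>UNIV. \<Sum>j\<in>UNIV. cnj (v $ i) * (\<chi> i j. L (starU (u i) * u j)) $ i $ j * v $ j)
      \<in> \<real>\<^sub>\<ge>\<^sub>0"
    by simp
qed

lemma gaussian_decomposition:
  fixes L :: "('n::finite) unitary_alg \<Rightarrow> complex"
  assumes "gaussian L"
  obtains \<sigma> b where "hermitian_matrix b" "pos_semidef_matrix \<sigma>"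
    "L = (\<lambda>x. gauss_sum \<sigma> x + drift_sum b x)"
proof -
  have gen: "generator L" and L: "linear_functional L" "L 1 = 0"
    and star: "L (starU z) = cnj (L z)" for z
    using assms by (auto simp: gaussian_def generator_def)
  define \<sigma> :: "complex^('n \<times> 'n)^('n \<times> 'n)"
    where "\<sigma> = (\<chi> p q. L (starU (uhat (fst p) (snd p)) * uhat (fst q) (snd q)))"
  have psd: "pos_semidef_matrix \<sigma>"
    unfolding \<sigma>_def by (rule gram_matrix_pos_semidef[OF gen]) simp
  have \<sigma>_herm: "cnj (\<sigma> $ (j, k) $ (l, m)) = \<sigma> $ (l, m) $ (j, k)" for j k l m
    by (simp add: \<sigma>_def starU_mult flip: star)
  define R where "R = (\<lambda>x. L x - gauss_sum \<sigma> x)"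
  have R: "linear_functional R"
    unfolding R_def by (rule linear_functional_minus[OF L(1) linear_functional_gauss_sum])
  \<comment> \<open>By the choice of \<sigma>, both terms of \<open>R\<close> expand into the same
    fourfold sum.\<close>
  have R_mult: "R (x * y) = 0" if "counit x = 0" "counit y = 0" for x y
    unfolding R_def gaussian_mult[OF assms that] gauss_sum_mult[OF that] by (simp add: \<sigma>_def)
  have R_star: "R (starU (uhat j k)) = - R (uhat k j)" for j k
    by (rule linear_functional_star_uhat[OF R R_mult])
  \<comment> \<open>The factor \<open>- \<i>\<close> cancels the \<open>\<i>\<close> in
    \<open>drift_sum_uhat\<close>.\<close>
  define b :: "complex^'n^'n" where "b = (\<chi> j k. - \<i> * R (uhat j k))"
  \<comment> \<open>\<open>R\<close> of a starred \<open>uhat\<close> is computed twice: as a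
    conjugate, since \<open>L\<close> and \<open>gauss_sum\<close> respect the involution there, and
    as minus the transposed value, since \<open>R\<close> kills K^2. So the values of
    \<open>R\<close> form a skew-hermitian matrix, and multiplying by \<open>- \<i>\<close> makes it
    hermitian.\<close>
  have "cnj (R (uhat j k)) = - R (uhat k j)" for j k
    unfolding R_star[symmetric] by (simp add: R_def star gauss_sum_star_uhat \<sigma>_herm)
  then have herm: "hermitian_matrix b"
    by (simp add: hermitian_matrix_def cadjoint_def b_def vec_eq_iff)
  have "R = drift_sum b"
  proof (rule linear_functional_eqI[OF R linear_functional_drift_sum])
    show "R 1 = drift_sum b 1"
      by (simp add: R_def L gauss_sum_1 drift_sum_1)
  qed (simp_all add: R_mult drift_sum_mult drift_sum_uhat b_def R_star)
  then have "L = (\<lambda>x. gauss_sum \<sigma> x + drift_sum b x)"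
    by (auto simp: R_def fun_eq_iff algebra_simps)
  with herm psd that show thesis by blast
qed

lemma gaussian_gauss_sum_drift_sum:
  assumes "generator L" and L: "L = (\<lambda>x. gauss_sum \<sigma> x + drift_sum b x)"
  shows "gaussian L"
proof -
  \<comment> \<open>On \<open>(a * b) * c\<close> every \<open>G_fun\<close> has the factor eta at
    \<open>starU b * starU a\<close>, which is 0 because this element lies in K^2.\<close>
  have cubic: "L (a * b * c) = 0" if "counit a = 0" "counit b = 0" "counit c = 0" for a b c
    using that by (simp add: L gauss_sum_mult drift_sum_mult counit_mult starU_mult counit_starU)
  have lin: "linear_functional L"
    using assms(1) by (simp add: generator_def)
  have "L x = 0" if "x \<in> ker_counit3" for x
    using that unfolding ker_counit3_def
  proof (induction rule: unitary_alg.span_induct_alt)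
    case base
    show ?case by (rule linear_functional_0[OF lin])
  next
    case (step c x y)
    then show ?case
      using lin cubic by (auto simp: linear_functional_iff ker_counit_def)
  qed
  with assms(1) show ?thesis by (simp add: gaussian_def)
qed

lemma drift_gauss_sum_drift_sum_iff:
  assumes "generator L" and L: "L = (\<lambda>x. gauss_sum \<sigma> x + drift_sum b x)"
  shows "drift L \<longleftrightarrow> (\<forall>j k l m. \<sigma> $ (j, k) $ (l, m) = 0)"
proof
  assume "drift L"
  \<comment> \<open>These elements of K^2 are the ones at which \<open>L\<close> takes the values
    \<sigma>.\<close>
  then have "L (starU (uhat j k) * uhat l m) = 0" for j k l m
    by (simp add: drift_def mult_in_ker_counit2)
  then show "\<forall>j k l m. \<sigma> $ (j, k) $ (l, m) = 0"
    by (simp add: L gauss_sum_star_uhat_mult_uhat drift_sum_mult)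
next
  assume "\<forall>j k l m. \<sigma> $ (j, k) $ (l, m) = 0"
  then have "L (x * y) = 0" if "counit x = 0" "counit y = 0" for x y
    using that by (simp add: L gauss_sum_mult drift_sum_mult)
  then show "drift L"
    using assms(1) by (simp add: drift_def generator_def vanish_ker2_iff)
qed

text \<open>The drift criterion ranges over all representations of \<open>L\<close>; this agrees
  with speaking of the coefficients of \<open>L\<close>, because \<open>L\<close> determines
  \<sigma> by its values on the products \<open>starU (uhat j k) * uhat l m\<close>.\<close>

theorem theorem8p3p1:
  fixes L :: "('n::finite) unitary_alg \<Rightarrow> complex"
  assumes "generator L"
  shows "(gaussian L \<longleftrightarrow>
      (\<exists>(\<sigma> :: complex^('n \<times> 'n)^('n \<times> 'n)) (b :: complex^'n^'n).
        hermitian_matrix b \<and> pos_semidef_matrix \<sigma> \<and>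
        L = (\<lambda>x. (\<Sum>j\<in>UNIV. \<Sum>k\<in>UNIV. \<Sum>l\<in>UNIV. \<Sum>m\<in>UNIV. \<sigma> $ (j, k) $ (l, m) * G_fun j k l m x)
          + (\<Sum>j\<in>UNIV. \<Sum>k\<in>UNIV. b $ j $ k * D_fun j k x))))
    \<and> (\<forall>(\<sigma> :: complex^('n \<times> 'n)^('n \<times> 'n)) (b :: complex^'n^'n).
        hermitian_matrix b \<longrightarrow> pos_semidef_matrix \<sigma> \<longrightarrow>
        L = (\<lambda>x. (\<Sum>j\<in>UNIV. \<Sum>k\<in>UNIV. \<Sum>l\<in>UNIV. \<Sum>m\<in>UNIV. \<sigma> $ (j, k) $ (l, m) * G_fun j k l m x)
          + (\<Sum>j\<in>UNIV. \<Sum>k\<in>UNIV. b $ j $ k * D_fun j k x)) \<longrightarrow>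
        (drift L \<longleftrightarrow> (\<forall>j k l m. \<sigma> $ (j, k) $ (l, m) = 0)))"
  unfolding gauss_sum_def[symmetric] drift_sum_def[symmetric]
  using gaussian_decomposition[of L] gaussian_gauss_sum_drift_sum[OF assms]
    drift_gauss_sum_drift_sum_iff[OF assms]
  by metis

end
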